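(* Let $A,B\in M_{n,m}$, and let $A',B'\in M_{n,m}$ be obtained from $A,B$ via Reduction (I) or via Reduction (II) described in the context. Then $A\preceq^d B$ if and only if $A'\preceq^d B'$. In addition, $B'$ is column stochastic. Moreover, if the majorization $A\preceq^d B$ holds, then $e^tA'=e^tB'$ and both $A'$ and $B'$ are column stochastic matrices.
   Context: $M_{n,m}$ is the space of real $n\times m$ matrices; $J$ is the $n\times m$ all-ones matrix; $e$ is the all-ones column vector of the appropriate size. A matrix is column stochastic if it is nonnegative with every column sum equal to $1$. For $x\in\mathbb{R}^n$, $x^\downarrow$ is the vector of entries of $x$ in non-increasing order; for $a,b\in\mathbb{R}^n$, $a\preceq b$ means $\sum_{j=1}^k a^\downarrow_j\le\sum_{j=1}^k b^\downarrow_j$ for $k=1,\ldots,n-1$ with equality of sums for $k=n$. Directional majorization: $A\preceq^d B$ means $Av\preceq Bv$ for every $v\in\mathbb{R}^m$. Reduction (I): choose any $\lambda\ge0$ such that $A_1=A+\lambda J$ and $B_1=B+\lambda J$ are nonnegative; choose any $\mu>0$ such that the column sums of $A_2=\frac1\mu A_1$ and $B_2=\frac1\mu B_1$ do not exceed $1$; define $v\in\mathbb{R}^m$ by $v^t=\frac1n(e^t-e^tB_2)$; put $A'=A_2+ev^t$, $B'=B_2+ev^t$. Reduction (II): choose any $\lambda\ge 0$ such that $A_1=A+\lambda J$ and $B_1=B+\lambda J$ are nonnegative and have no zero columns; let $D=\mathrm{diag}(e^tB_1)$ be the $m\times m$ diagonal matrix of the column sums of $B_1$; put $A'=A_1D^{-1}$,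 $B'=B_1D^{-1}$. *)

theory Defs
  imports "HOL-Analysis.Analysis" "HOL-Library.Multiset"
begin

text \<open>A real matrix with \<open>n\<close> rows and \<open>m\<close> columns has type \<^typ>\<open>real^'m^'n\<close>:
  the column index type comes first, and \<open>A $ i $ j\<close> is the entry in row \<open>i\<close>, column \<open>j\<close>.\<close>

definition all_ones_vec :: "real^'n" where
  "all_ones_vec = (\<chi> i. 1)"

definition all_ones_mat :: "real^'m^'n" where
  "all_ones_mat = (\<chi> i j. 1)"

definition nonneg_mat :: "real^'m^'n \<Rightarrow> bool" where
  "nonneg_mat A \<longleftrightarrow> (\<forall>i j. 0 \<le> A $ i $ j)"

definition column_stochastic :: "real^'m^'n \<Rightarrow> bool" where
  "column_stochastic A \<longleftrightarrow> nonneg_mat A \<and> (\<forall>j. (\<Sum>i\<in>UNIV. A $ i $ j) = 1)"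

definition decreasing :: "real^'n \<Rightarrow> real list" where
  "decreasing x = rev (sorted_list_of_multiset (image_mset (\<lambda>i. x $ i) (mset_set UNIV)))"

lemma length_decreasing: "length (decreasing (x :: real^'n)) = CARD('n)"
  unfolding decreasing_def
  by (metis length_rev mset_sorted_list_of_multiset size_image_mset size_mset size_mset_set)

text \<open>List positions count from 0, so the \<open>k\<close> largest entries are those at positions \<open>j < k\<close>.\<close>

definition majorized :: "real^'n \<Rightarrow> real^'n \<Rightarrow> bool" where
  "majorized a b \<longleftrightarrow>
     (\<forall>k\<in>{1..CARD('n) - 1}. (\<Sum>j<k. decreasing a ! j) \<le> (\<Sum>j<k. decreasing b ! j)) \<and>
     (\<Sum>j<CARD('n). decreasing a ! j) = (\<Sum>j<CARD('n). decreasing b ! j)"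

definition directionally_majorized :: "real^'m^'n \<Rightarrow> real^'m^'n \<Rightarrow> bool" where
  "directionally_majorized A B \<longleftrightarrow> (\<forall>v. majorized (A *v v) (B *v v))"

definition outer_product :: "real^'n \<Rightarrow> real^'m \<Rightarrow> real^'m^'n" where
  "outer_product u v = (\<chi> i j. u $ i * v $ j)"

definition diag_mat :: "real^'m \<Rightarrow> real^'m^'m" where
  "diag_mat d = (\<chi> i j. if i = j then d $ i else 0)"

text \<open>The parameters of both reductions may be chosen freely subject to the stated constraints,
  so each reduction is a relation: \<open>(A', B')\<close> is a possible outcome on input \<open>(A, B)\<close>.
  Row vectors such as $e^t B$ are written \<open>e v* B\<close>.\<close>

definition reduction_I ::
  "real^'m^'n \<Rightarrow> real^'m^'n \<Rightarrow> real^'m^'n \<Rightarrow> real^'m^'n \<Rightarrow> bool" where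
  "reduction_I A B A' B' \<longleftrightarrow>
     (\<exists>l \<mu> A1 B1 A2 B2 v.
        0 \<le> l \<and> A1 = A + l *\<^sub>R all_ones_mat \<and> B1 = B + l *\<^sub>R all_ones_mat \<and>
        nonneg_mat A1 \<and> nonneg_mat B1 \<and>
        0 < \<mu> \<and> A2 = (1 / \<mu>) *\<^sub>R A1 \<and> B2 = (1 / \<mu>) *\<^sub>R B1 \<and>
        (\<forall>j. (\<Sum>i\<in>UNIV. A2 $ i $ j) \<le> 1) \<and> (\<forall>j. (\<Sum>i\<in>UNIV. B2 $ i $ j) \<le> 1) \<and>
        v = (1 / real CARD('n)) *\<^sub>R (all_ones_vec - all_ones_vec v* B2) \<and>
        A' = A2 + outer_product all_ones_vec v \<and> B' = B2 + outer_product all_ones_vec v)"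

definition reduction_II ::
  "real^'m^'n \<Rightarrow> real^'m^'n \<Rightarrow> real^'m^'n \<Rightarrow> real^'m^'n \<Rightarrow> bool" where
  "reduction_II A B A' B' \<longleftrightarrow>
     (\<exists>l A1 B1 D.
        0 \<le> l \<and> A1 = A + l *\<^sub>R all_ones_mat \<and> B1 = B + l *\<^sub>R all_ones_mat \<and>
        nonneg_mat A1 \<and> nonneg_mat B1 \<and>
        (\<forall>j. column j A1 \<noteq> 0) \<and> (\<forall>j. column j B1 \<noteq> 0) \<and>
        D = diag_mat (all_ones_vec v* B1) \<and>
        A' = A1 ** matrix_inv D \<and> B' = B1 ** matrix_inv D)"

end

theory Submission
  imports Defs
begin

text \<open>In both reductions \<open>A'\<close> and \<open>B'\<close> arise from \<open>A\<close> and \<open>B\<close> by the same rule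
  \<open>A' x = c (A (P x)) + t(x) e\<close>, with \<open>c > 0\<close> and \<open>P\<close> surjective. The entries of
  \<open>c a + t e\<close> are the images of those of \<open>a\<close> under an increasing affine map, so sorting commutes
  with it, and all partial sums in the definition of majorization change by the same affine rule
  on both sides (\<open>majorized_affine_iff\<close>). As \<open>P x\<close> runs through all directions, directional
  majorization is preserved and reflected (\<open>directionally_majorized_transform_iff\<close>).

  That \<open>B'\<close> is column stochastic and \<open>A'\<close> nonnegative is immediate from the choice of \<open>v\<close> in (I)
  and of \<open>D\<close> in (II). The last claim then concerns \<open>A'\<close> and \<open>B'\<close> only: majorization in the
  direction of a standard basis vector compares two columns, and majorized vectors have equal
  sums, so \<open>A'\<close> inherits its column sums from \<open>B'\<close>.\<close>

section \<open>Majorization under affine maps\<close>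

text \<open>The positivity of \<open>c\<close> makes the affine map increasing, so it keeps sorted lists sorted.\<close>

lemma decreasing_affine:
  fixes x :: "real^'n"
  assumes "0 < c"
  shows "decreasing (c *\<^sub>R x + t *\<^sub>R all_ones_vec) = map (\<lambda>z. c * z + t) (decreasing x)"
proof -
  define M where "M = image_mset (\<lambda>i. x $ i) (mset_set (UNIV :: 'n set))"
  define xs where "xs = sorted_list_of_multiset M"
  let ?f = "\<lambda>z. c * z + t"
  have "image_mset (\<lambda>i. (c *\<^sub>R x + t *\<^sub>R all_ones_vec) $ i) (mset_set UNIV) = mset (map ?f xs)"
    by (simp add: xs_def M_def all_ones_vec_def image_mset.compositionality o_def)
  moreover have "sorted xs"
    by (simp add: xs_def)
  then have "sorted (map ?f xs)"
    using assms by (auto simp: sorted_iff_nth_mono)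
  ultimately have "decreasing (c *\<^sub>R x + t *\<^sub>R all_ones_vec) = rev (map ?f xs)"
    by (simp only: decreasing_def sorted_list_of_multiset_mset sorted_sort_id)
  then show ?thesis
    by (simp add: decreasing_def rev_map xs_def M_def)
qed

lemma majorized_affine_iff:
  fixes x y :: "real^'n"
  assumes "0 < c"
  shows "majorized (c *\<^sub>R x + t *\<^sub>R all_ones_vec) (c *\<^sub>R y + t *\<^sub>R all_ones_vec) \<longleftrightarrow> majorized x y"
proof -
  have partial_sum: "(\<Sum>j<k. decreasing (c *\<^sub>R z + t *\<^sub>R all_ones_vec) ! j) =
      c * (\<Sum>j<k. decreasing z ! j) + real k * t" if "k \<le> CARD('n)" for k and z :: "real^'n"
  proof -
    have "(\<Sum>j<k. decreasing (c *\<^sub>R z + t *\<^sub>R all_ones_vec) ! j) =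
        (\<Sum>j<k. c * decreasing z ! j + t)"
      using that by (intro sum.cong) (auto simp: decreasing_affine[OF assms] length_decreasing)
    then show ?thesis
      by (simp add: sum.distrib sum_distrib_left)
  qed
  show ?thesis
    unfolding majorized_def using assms
    by (intro arg_cong2[where f = "(\<and>)"] ball_cong) (auto simp: partial_sum)
qed

text \<open>Both reductions act in this way: adding multiples of \<open>e\<close> to the columns shifts \<open>A x\<close> by a
  multiple \<open>t x\<close> of \<open>e\<close> that depends on the direction but is common to \<open>A\<close> and \<open>B\<close>; scaling
  the columns reparametrizes the directions.\<close>

lemma directionally_majorized_transform_iff:
  fixes A B :: "real^'m^'n" and A' B' :: "real^'p^'n"
  assumes "0 < c" and "surj P"
    and A': "\<And>x. A' *v x = c *\<^sub>R (A *v P x) + t x *\<^sub>R all_ones_vec"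
    and B': "\<And>x. B' *v x = c *\<^sub>R (B *v P x) + t x *\<^sub>R all_ones_vec"
  shows "directionally_majorized A B \<longleftrightarrow> directionally_majorized A' B'"
proof -
  have "directionally_majorized A' B' \<longleftrightarrow> (\<forall>x. majorized (A *v P x) (B *v P x))"
    by (simp add: directionally_majorized_def A' B' majorized_affine_iff[OF \<open>0 < c\<close>])
  also have "\<dots> \<longleftrightarrow> directionally_majorized A B"
    unfolding directionally_majorized_def using \<open>surj P\<close> by (metis surjD)
  finally show ?thesis by simp
qed

section \<open>Column sums\<close>

lemma sum_decreasing: "(\<Sum>j<CARD('n). decreasing x ! j) = (\<Sum>i\<in>UNIV. x $ i)" for x :: "real^'n"
proof -
  have "(\<Sum>j<CARD('n). decreasing x ! j) = sum_list (decreasing x)"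
    by (simp add: sum_list_sum_nth length_decreasing atLeast0LessThan)
  also have "\<dots> = sum_mset (mset (decreasing x))"
    by (simp add: sum_mset_sum_list)
  also have "\<dots> = (\<Sum>i\<in>UNIV. x $ i)"
    by (simp only: decreasing_def mset_rev mset_sorted_list_of_multiset sum_unfold_sum_mset)
  finally show ?thesis .
qed

lemma all_ones_vec_mult_nth: "(all_ones_vec v* A) $ j = (\<Sum>i\<in>UNIV. A $ i $ j)"
  by (simp add: vector_matrix_mult_def all_ones_vec_def)

text \<open>The columns are the images of the standard basis vectors, which are among the directions
  in which \<open>A\<close> and \<open>B\<close> are compared. Majorization of two columns makes their sums equal.\<close>

lemma directionally_majorized_column_sums:
  assumes "directionally_majorized A B"
  shows "all_ones_vec v* A = all_ones_vec v* B"
proof -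
  have "(\<Sum>i\<in>UNIV. A $ i $ j) = (\<Sum>i\<in>UNIV. B $ i $ j)" for j
  proof -
    have "majorized (column j A) (column j B)"
      using assms unfolding directionally_majorized_def by (metis matrix_vector_mult_basis)
    then show ?thesis
      by (simp add: majorized_def sum_decreasing column_def)
  qed
  then show ?thesis
    by (simp add: vec_eq_iff all_ones_vec_mult_nth)
qed

lemma column_stochastic_if_directionally_majorized:
  assumes "directionally_majorized A B" "nonneg_mat A" "column_stochastic B"
  shows "column_stochastic A"
  using directionally_majorized_column_sums[OF assms(1)] assms(2,3)
  by (simp add: column_stochastic_def vec_eq_iff all_ones_vec_mult_nth)

section \<open>The two reductions\<close>

lemma all_ones_mat_mult_vec:
  "(all_ones_mat :: real^'m^'n) *v x = (\<Sum>j\<in>UNIV. x $ j) *\<^sub>R all_ones_vec"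
  by (simp add: vec_eq_iff matrix_vector_mult_def all_ones_mat_def all_ones_vec_def)

lemma outer_product_mult_vec: "outer_product u v *v x = (v \<bullet> x) *\<^sub>R u"
  by (simp add: vec_eq_iff matrix_vector_mult_def outer_product_def inner_vec_def
      sum_distrib_left ac_simps)

text \<open>The vector \<open>v\<close> distributes the deficit \<open>1 - (\<Sum>i. B2 $ i $ j)\<close> of column \<open>j\<close> evenly over the
  \<open>n\<close> rows. Column sums of at most one make it nonnegative, so adding it preserves
  nonnegativity of both matrices.\<close>

lemma reduction_I_properties:
  fixes A B A' B' :: "real^'m^'n"
  assumes "reduction_I A B A' B'"
  shows "directionally_majorized A B \<longleftrightarrow> directionally_majorized A' B'"
    and "nonneg_mat A'" and "column_stochastic B'"
proof -
  obtain l \<mu> A2 B2 v where "0 < \<mu>"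
    and nonneg: "nonneg_mat (A + l *\<^sub>R all_ones_mat)" "nonneg_mat (B + l *\<^sub>R all_ones_mat)"
    and A2: "A2 = (1 / \<mu>) *\<^sub>R (A + l *\<^sub>R all_ones_mat)"
    and B2: "B2 = (1 / \<mu>) *\<^sub>R (B + l *\<^sub>R all_ones_mat)"
    and le1: "\<And>j. (\<Sum>i\<in>UNIV. B2 $ i $ j) \<le> 1"
    and v: "v = (1 / real CARD('n)) *\<^sub>R (all_ones_vec - all_ones_vec v* B2)"
    and A': "A' = A2 + outer_product all_ones_vec v"
    and B': "B' = B2 + outer_product all_ones_vec v"
    using assms unfolding reduction_I_def by blast
  have v_nth: "v $ j = (1 - (\<Sum>i\<in>UNIV. B2 $ i $ j)) / real CARD('n)" for j
    by (simp add: v all_ones_vec_mult_nth) (simp add: all_ones_vec_def)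
  have v_nonneg: "0 \<le> v $ j" for j
    using le1[of j] by (simp add: v_nth)
  have nonneg2: "nonneg_mat A2" "nonneg_mat B2"
    using nonneg \<open>0 < \<mu>\<close> by (auto simp: nonneg_mat_def A2 B2)
  then show "nonneg_mat A'"
    using v_nonneg by (simp add: nonneg_mat_def A' outer_product_def all_ones_vec_def)
  have "nonneg_mat B'"
    using nonneg2 v_nonneg by (simp add: nonneg_mat_def B' outer_product_def all_ones_vec_def)
  moreover have "(\<Sum>i\<in>UNIV. B' $ i $ j) = 1" for j
    by (simp add: B' outer_product_def all_ones_vec_def sum.distrib v_nth)
  ultimately show "column_stochastic B'"
    by (simp add: column_stochastic_def)
  \<comment> \<open>The shift in direction \<open>x\<close> collects the rescaled multiple of \<open>J\<close> and the rank-one term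
    \<open>e v\<^sup>t\<close>.\<close>
  define t where "t x = l / \<mu> * (\<Sum>j\<in>UNIV. x $ j) + v \<bullet> x" for x
  have transform: "((1 / \<mu>) *\<^sub>R (C + l *\<^sub>R all_ones_mat) + outer_product all_ones_vec v) *v x =
      (1 / \<mu>) *\<^sub>R (C *v id x) + t x *\<^sub>R all_ones_vec" for C :: "real^'m^'n" and x
    by (simp add: scaleR_matrix_vector_assoc[symmetric] all_ones_mat_mult_vec outer_product_mult_vec t_def algebra_simps)
  show "directionally_majorized A B \<longleftrightarrow> directionally_majorized A' B'"
    by (rule directionally_majorized_transform_iff[where c = "1 / \<mu>" and P = id and t = t])
      (use \<open>0 < \<mu>\<close> in \<open>simp_all only: A' B' A2 B2 transform, simp_all\<close>)
qed

lemma matrix_mult_diag_mat_nth: "(A ** diag_mat d) $ i $ j = A $ i $ j * d $ j"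
proof -
  have "(A ** diag_mat d) $ i $ j = (\<Sum>k\<in>UNIV. if k = j then A $ i $ k * d $ k else 0)"
    unfolding matrix_matrix_mult_def diag_mat_def vec_lambda_beta
    by (intro sum.cong) auto
  then show ?thesis by simp
qed

lemma diag_mat_mult_diag_mat: "diag_mat d ** diag_mat e = diag_mat (\<chi> j. d $ j * e $ j)"
  by (simp add: vec_eq_iff matrix_mult_diag_mat_nth) (simp add: diag_mat_def)

lemma diag_mat_inverse:
  assumes "\<And>j. d $ j \<noteq> 0"
  shows "diag_mat d ** diag_mat (\<chi> j. inverse (d $ j)) = mat 1"
    and "diag_mat (\<chi> j. inverse (d $ j)) ** diag_mat d = mat 1"
  unfolding diag_mat_mult_diag_mat by (simp_all add: assms diag_mat_def mat_def vec_eq_iff)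

text \<open>As \<open>matrix_inv\<close> is defined by a choice operator, its value on a concrete matrix is read off from
  the uniqueness of two-sided inverses.\<close>

lemma matrix_inv_eqI:
  fixes A :: "'a::semiring_1^'n^'m"
  assumes "A ** B = mat 1" and "B ** A = mat 1"
  shows "matrix_inv A = B"
proof -
  have "matrix_inv A ** A = mat 1"
    unfolding matrix_inv_def by (rule someI2[of _ B]) (use assms in auto)
  then show ?thesis
    by (metis assms(1) matrix_mul_assoc matrix_mul_lid matrix_mul_rid)
qed

lemma matrix_inv_diag_mat:
  assumes "\<And>j. d $ j \<noteq> 0"
  shows "matrix_inv (diag_mat d) = diag_mat (\<chi> j. inverse (d $ j))"
  using diag_mat_inverse[OF assms] by (rule matrix_inv_eqI)

text \<open>A nonnegative matrix without zero columns has positive column sums. Hence \<open>D\<close> is invertible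
  with a positive diagonal inverse, which normalizes the columns of \<open>B1\<close> and maps onto all
  directions.\<close>

lemma reduction_II_properties:
  fixes A B A' B' :: "real^'m^'n"
  assumes "reduction_II A B A' B'"
  shows "directionally_majorized A B \<longleftrightarrow> directionally_majorized A' B'"
    and "nonneg_mat A'" and "column_stochastic B'"
proof -
  obtain l A1 B1 D where A1: "A1 = A + l *\<^sub>R all_ones_mat" and B1: "B1 = B + l *\<^sub>R all_ones_mat"
    and nonneg: "nonneg_mat A1" "nonneg_mat B1"
    and nonzero: "\<And>j. column j B1 \<noteq> 0"
    and D: "D = diag_mat (all_ones_vec v* B1)"
    and A': "A' = A1 ** matrix_inv D" and B': "B' = B1 ** matrix_inv D"
    using assms unfolding reduction_II_def by blast
  define s where "s = all_ones_vec v* B1"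
  have s_pos: "0 < s $ j" for j
  proof -
    obtain i where "B1 $ i $ j \<noteq> 0"
      using nonzero[of j] by (auto simp: vec_eq_iff column_def)
    then have "0 < B1 $ i $ j"
      using nonneg(2) by (simp add: nonneg_mat_def order_less_le)
    then show ?thesis
      using nonneg(2) by (auto simp: s_def all_ones_vec_mult_nth nonneg_mat_def intro!: sum_pos2)
  qed
  define E where "E = diag_mat (\<chi> j. inverse (s $ j))"
  have s_nz: "s $ j \<noteq> 0" for j
    using s_pos[of j] by simp
  have inv_D: "matrix_inv D = E"
    by (simp add: D E_def matrix_inv_diag_mat s_nz flip: s_def)
  show "nonneg_mat A'"
    using nonneg(1) s_pos
    by (simp add: nonneg_mat_def A' inv_D E_def matrix_mult_diag_mat_nth less_imp_le)
  have "nonneg_mat B'"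
    using nonneg(2) s_pos
    by (simp add: nonneg_mat_def B' inv_D E_def matrix_mult_diag_mat_nth less_imp_le)
  moreover have "(\<Sum>i\<in>UNIV. B' $ i $ j) = 1" for j
  proof -
    have "(\<Sum>i\<in>UNIV. B' $ i $ j) = s $ j * inverse (s $ j)"
      by (simp add: B' inv_D E_def matrix_mult_diag_mat_nth s_def all_ones_vec_mult_nth
          sum_distrib_right)
    then show ?thesis using s_nz by simp
  qed
  ultimately show "column_stochastic B'"
    by (simp add: column_stochastic_def)
  define t where "t x = l * (\<Sum>j\<in>UNIV. (E *v x) $ j)" for x
  have transform: "((C + l *\<^sub>R all_ones_mat) ** E) *v x =
      1 *\<^sub>R (C *v (E *v x)) + t x *\<^sub>R all_ones_vec" for C :: "real^'m^'n" and x
    by (simp add: matrix_vector_mul_assoc[symmetric] matrix_vector_mult_add_rdistrib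
        scaleR_matrix_vector_assoc[symmetric] all_ones_mat_mult_vec t_def)
  have "E *v (diag_mat s *v y) = y" for y
    by (simp add: matrix_vector_mul_assoc E_def diag_mat_inverse(2) s_nz)
  then have "surj ((*v) E)"
    by (metis surjI)
  then show "directionally_majorized A B \<longleftrightarrow> directionally_majorized A' B'"
    by (rule directionally_majorized_transform_iff[OF zero_less_one, where t = t])
      (simp_all only: A' B' A1 B1 inv_D transform)
qed

section \<open>Invariance under the reductions\<close>

theorem corollary3p14:
  fixes A B A' B' :: "real^'m^'n"
  assumes "reduction_I A B A' B' \<or> reduction_II A B A' B'"
  shows "(directionally_majorized A B \<longleftrightarrow> directionally_majorized A' B') \<and>
         column_stochastic B' \<and>
         (directionally_majorized A B \<longrightarrow>
            all_ones_vec v* A' = all_ones_vec v* B' \<and>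
            column_stochastic A' \<and> column_stochastic B')"
proof -
  have iff: "directionally_majorized A B \<longleftrightarrow> directionally_majorized A' B'"
    using assms reduction_I_properties(1) reduction_II_properties(1) by metis
  have "nonneg_mat A'"
    using assms reduction_I_properties(2) reduction_II_properties(2) by metis
  moreover have "column_stochastic B'"
    using assms reduction_I_properties(3) reduction_II_properties(3) by metis
  ultimately show ?thesis
    using iff directionally_majorized_column_sums[of A' B']
      column_stochastic_if_directionally_majorized[of A' B'] by simp
qed

end
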